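(* Let $k>1$ be a fixed integer and let $X$ be a quandle of type $k$, so that $X$ satisfies the identity $S$: $x*^k y=x$ for all $x,y\in X$. Then the following hold. (i) For all $x,y\in X$, the $2$-chain $L_S=L_S(x,y)=\sum_{i=0}^{k-1}(x*^i y,\,y)\in C_2(X)$ is a rack $2$-cycle, i.e. $\partial_2(L_S)=0$. (ii) For every abelian group $A$ and every rack $2$-cocycle $\phi:X\times X\to A$, the abelian extension $E(X,A,\phi)$ satisfies $S$ (i.e. $u*^k v=u$ for all $u,v\in E(X,A,\phi)$) if and only if $\phi(L_S(x,y))=0$ for all $x,y\in X$. (iii) For each $n$, let $C^S_n(X)$ be the subgroup of $C_n(X)$ generated by all elements $$\sum_{i=0}^{k-1}(x_1*^i y,\dots,x_j*^i y,\,y,\,x_{j+2},\dots,x_n),$$ where $0\le j\le n-1$, $y\in X$, and $x_h\in X$ for $h\in\{1,\dots,n\}\setminus\{j+1\}$. Then $\{C_n^S(X),\partial_n\}$ is a subcomplex of $\{C_n(X),\partial_n\}$, i.e. $\partial_n(C_n^S(X))\subset C_{n-1}^S(X)$ for all $n$.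
   Context: A rack is a non-empty set $X$ with a binary operation $*$ such that (1) for every $b\in X$ the map $R_b:X\to X$, $R_b(a)=a*b$, is a bijection, and (2) $(a*b)*c=(a*c)*(b*c)$ for all $a,b,c\in X$. A quandle is a rack with $a*a=a$ for all $a$. Write $x*^i y=(\cdots((x*y)*y)\cdots)*y$ with $y$ repeated $i$ times, and $x*^0y=x$. A rack $X$ is of type $k$ if $k$ is the least positive integer such that $x*^k y=x$ for all $x,y\in X$. Rack chain complex: for $n\ge1$, $C_n(X)$ is the free abelian group on $n$-tuples $(x_1,\dots,x_n)\in X^n$, and $C_n(X)=0$ for $n\le0$. The boundary is $\partial_n=\sum_{h=2}^n(-1)^h[d_h^{(n)}-\delta_h^{(n)}]$, where $d_h^{(n)}(x_1,\dots,x_n)=(x_1,\dots,\widehat{x_h},\dots,x_n)$ and $\delta_h^{(n)}(x_1,\dots,x_n)=(x_1*x_h,\dots,x_{h-1}*x_h,\widehat{x_h},x_{h+1},\dots,x_n)$ (hat means the entry is deleted). A rack $2$-cocycle with values in an abelian group $A$ is a function $\phi:X\times X\to A$ with $\phi(x,y)-\phi(x,z)+\phi(x*y,z)-\phi(x*z,y*z)=0$ for all $x,y,z\in X$; it is extended linearly to $C_2(X)$. The abelian extension $E(X,A,\phi)$ is the rack $X\times A$ with operation $(x,a)*(y,b)=(x*y,\,a+\phi(x,y))$. *)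

theory Defs
  imports "HOL-Algebra.Free_Abelian_Groups" "HOL-Algebra.Generated_Groups"
begin

section \<open>Racks and quandles\<close>

locale rack =
  fixes X :: "'a set" and rop :: "'a \<Rightarrow> 'a \<Rightarrow> 'a" (infixl \<open>\<star>\<close> 70)
  assumes nonempty: "X \<noteq> {}"
    and right_translation_bij: "b \<in> X \<Longrightarrow> bij_betw (\<lambda>a. a \<star> b) X X"
    and right_distrib:
      "\<lbrakk>a \<in> X; b \<in> X; c \<in> X\<rbrakk> \<Longrightarrow> (a \<star> b) \<star> c = (a \<star> c) \<star> (b \<star> c)"

locale quandle = rack +
  assumes idem: "a \<in> X \<Longrightarrow> a \<star> a = a"

definition rack_iter :: "('a \<Rightarrow> 'a \<Rightarrow> 'a) \<Rightarrow> nat \<Rightarrow> 'a \<Rightarrow> 'a \<Rightarrow> 'a"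
  where "rack_iter rop i x y = ((\<lambda>z. rop z y) ^^ i) x"

definition satisfies_S :: "'a set \<Rightarrow> ('a \<Rightarrow> 'a \<Rightarrow> 'a) \<Rightarrow> nat \<Rightarrow> bool"
  where "satisfies_S X rop k \<longleftrightarrow> (\<forall>x\<in>X. \<forall>y\<in>X. rack_iter rop k x y = x)"

definition rack_of_type :: "'a set \<Rightarrow> ('a \<Rightarrow> 'a \<Rightarrow> 'a) \<Rightarrow> nat \<Rightarrow> bool"
  where "rack_of_type X rop k \<longleftrightarrow>
    0 < k \<and> satisfies_S X rop k \<and> (\<forall>m. 0 < m \<and> m < k \<longrightarrow> \<not> satisfies_S X rop m)"

section \<open>The rack chain complex\<close>

text \<open>Degrees are integers. For \<open>n \<le> 0\<close> the set of generators is empty, so the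
  chain group is trivial; in particular the empty list is not a generator in degree 0.\<close>

definition rack_tuples :: "'a set \<Rightarrow> int \<Rightarrow> 'a list set"
  where "rack_tuples X n = {xs. 1 \<le> n \<and> int (length xs) = n \<and> set xs \<subseteq> X}"

definition rack_chain_group :: "'a set \<Rightarrow> int \<Rightarrow> ('a list \<Rightarrow>\<^sub>0 int) monoid"
  where "rack_chain_group X n = free_Abelian_group (rack_tuples X n)"

text \<open>Entries are numbered from 1 as usual in the literature, whereas \<open>xs ! i\<close> counts
  from 0: the entry \<open>x\<^sub>h\<close> is \<open>xs ! (h - 1)\<close>.\<close>

definition face_d :: "nat \<Rightarrow> 'a list \<Rightarrow> 'a list"
  where "face_d h xs = take (h - 1) xs @ drop h xs"

definition face_delta :: "('a \<Rightarrow> 'a \<Rightarrow> 'a) \<Rightarrow> nat \<Rightarrow> 'a list \<Rightarrow> 'a list"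
  where "face_delta rop h xs = map (\<lambda>x. rop x (xs ! (h - 1))) (take (h - 1) xs) @ drop h xs"

definition rack_boundary ::
    "('a \<Rightarrow> 'a \<Rightarrow> 'a) \<Rightarrow> int \<Rightarrow> ('a list \<Rightarrow>\<^sub>0 int) \<Rightarrow> ('a list \<Rightarrow>\<^sub>0 int)"
  where "rack_boundary rop n =
    frag_extend (\<lambda>xs. \<Sum>h\<in>{2..nat n}.
      frag_cmul ((-1) ^ h) (frag_of (face_d h xs) - frag_of (face_delta rop h xs)))"

definition L_chain :: "('a \<Rightarrow> 'a \<Rightarrow> 'a) \<Rightarrow> nat \<Rightarrow> 'a \<Rightarrow> 'a \<Rightarrow> ('a list \<Rightarrow>\<^sub>0 int)"
  where "L_chain rop k x y = (\<Sum>i<k. frag_of [rack_iter rop i x y, y])"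

text \<open>In a generator the list \<open>us\<close> is \<open>x\<^sub>1, \<dots>, x\<^sub>j\<close> and \<open>vs\<close> is
  \<open>x\<^bsub>j+2\<^esub>, \<dots>, x\<^sub>n\<close>; both may be empty.\<close>

definition S_generators ::
    "'a set \<Rightarrow> ('a \<Rightarrow> 'a \<Rightarrow> 'a) \<Rightarrow> nat \<Rightarrow> int \<Rightarrow> ('a list \<Rightarrow>\<^sub>0 int) set"
  where "S_generators X rop k n =
    {(\<Sum>i<k. frag_of (map (\<lambda>x. rack_iter rop i x y) us @ y # vs)) | us y vs.
       set us \<subseteq> X \<and> y \<in> X \<and> set vs \<subseteq> X \<and> int (length us + 1 + length vs) = n}"

definition S_chains ::
    "'a set \<Rightarrow> ('a \<Rightarrow> 'a \<Rightarrow> 'a) \<Rightarrow> nat \<Rightarrow> int \<Rightarrow> ('a list \<Rightarrow>\<^sub>0 int) set"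
  where "S_chains X rop k n = generate (rack_chain_group X n) (S_generators X rop k n)"

section \<open>Cocycles and abelian extensions\<close>

text \<open>The abelian group \<open>A\<close> of coefficients is written multiplicatively, following the
  conventions for \<^locale>\<open>comm_group\<close>.\<close>

definition rack_2_cocycle ::
    "'a set \<Rightarrow> ('a \<Rightarrow> 'a \<Rightarrow> 'a) \<Rightarrow> ('b, 'c) monoid_scheme \<Rightarrow> ('a \<times> 'a \<Rightarrow> 'b) \<Rightarrow> bool"
  where "rack_2_cocycle X rop A \<phi> \<longleftrightarrow>
    \<phi> \<in> X \<times> X \<rightarrow> carrier A \<and>
    (\<forall>x\<in>X. \<forall>y\<in>X. \<forall>z\<in>X.
       \<phi> (x, y) \<otimes>\<^bsub>A\<^esub> inv\<^bsub>A\<^esub> \<phi> (x, z) \<otimes>\<^bsub>A\<^esub> \<phi> (rop x y, z)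
         \<otimes>\<^bsub>A\<^esub> inv\<^bsub>A\<^esub> \<phi> (rop x z, rop y z) = \<one>\<^bsub>A\<^esub>)"

text \<open>The linear extension of \<open>\<phi>\<close> to 2-chains.\<close>

definition eval_2_chain ::
    "('b, 'c) monoid_scheme \<Rightarrow> ('a \<times> 'a \<Rightarrow> 'b) \<Rightarrow> ('a list \<Rightarrow>\<^sub>0 int) \<Rightarrow> 'b"
  where "eval_2_chain A \<phi> c =
    (\<Otimes>\<^bsub>A\<^esub>xs\<in>Poly_Mapping.keys c. \<phi> (xs ! 0, xs ! 1) [^]\<^bsub>A\<^esub> (Poly_Mapping.lookup c xs))"

definition ext_carrier :: "'a set \<Rightarrow> ('b, 'c) monoid_scheme \<Rightarrow> ('a \<times> 'b) set"
  where "ext_carrier X A = X \<times> carrier A"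

definition ext_op ::
    "('a \<Rightarrow> 'a \<Rightarrow> 'a) \<Rightarrow> ('b, 'c) monoid_scheme \<Rightarrow> ('a \<times> 'a \<Rightarrow> 'b)
      \<Rightarrow> 'a \<times> 'b \<Rightarrow> 'a \<times> 'b \<Rightarrow> 'a \<times> 'b"
  where "ext_op rop A \<phi> u v =
    (rop (fst u) (fst v), snd u \<otimes>\<^bsub>A\<^esub> \<phi> (fst u, fst v))"

end

theory Submission
  imports Defs
begin

text \<open>Fix \<open>y\<close>. Since \<open>R\<^sub>y\<close> is an automorphism and every \<open>R\<^sub>z\<close> carries \<open>R\<^sub>y\<close> to
  \<open>R\<^bsub>y \<star> z\<^esub>\<close>, every face of a generator of \<open>C\<^sup>S\<close> other than those deleting \<open>y\<close> is again a
  generator. The two faces deleting \<open>y\<close> differ by the shift \<open>i \<mapsto> i + 1\<close>, so their difference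
  telescopes to \<open>0\<close> by the identity \<open>S\<close>; this also gives \<open>\<partial> L\<^sub>S = 0\<close>. In the abelian extension,
  iterating the right translation by \<open>(y, b)\<close> accumulates the values of the cocycle along
  the same orbit.\<close>

section \<open>Iterated right translations and the faces of tuples\<close>

lemma rack_iter_0 [simp]: "rack_iter rop 0 x y = x"
  by (simp add: rack_iter_def)

lemma rack_iter_Suc [simp]: "rack_iter rop (Suc i) x y = rop (rack_iter rop i x y) y"
  by (simp add: rack_iter_def)

lemma face_d_append:
  "h \<le> length us \<Longrightarrow> 0 < h \<Longrightarrow> face_d h (us @ vs) = face_d h us @ vs"
  by (simp add: face_d_def)

lemma face_delta_append:
  "h \<le> length us \<Longrightarrow> 0 < h \<Longrightarrow> face_delta rop h (us @ vs) = face_delta rop h us @ vs"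
  by (simp add: face_delta_def nth_append)

lemma length_face_d: "0 < h \<Longrightarrow> h \<le> length xs \<Longrightarrow> length (face_d h xs) = length xs - 1"
  by (simp add: face_d_def)

lemma length_face_delta:
  "0 < h \<Longrightarrow> h \<le> length xs \<Longrightarrow> length (face_delta rop h xs) = length xs - 1"
  by (simp add: face_delta_def)

lemma face_d_map: "face_d h (map f xs) = map f (face_d h xs)"
  by (simp add: face_d_def take_map drop_map)

lemma set_face_d: "set (face_d h xs) \<subseteq> set xs"
  by (auto simp: face_d_def dest: in_set_takeD in_set_dropD)

context rack
begin

lemma op_closed: "a \<in> X \<Longrightarrow> b \<in> X \<Longrightarrow> a \<star> b \<in> X"
  using right_translation_bij[of b] by (auto simp: bij_betw_def)

lemma rack_iter_closed: "x \<in> X \<Longrightarrow> y \<in> X \<Longrightarrow> rack_iter (\<star>) i x y \<in> X"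
  by (induction i) (auto intro: op_closed)

text \<open>\<open>right_distrib\<close> makes the right translation by \<open>z\<close> an
  endomorphism that turns each further translation by \<open>y\<close> into one by
  \<open>y \<star> z\<close>. This handles faces that delete an entry to the right of
  \<open>y\<close>.\<close>

lemma rack_iter_translate:
  assumes "x \<in> X" "y \<in> X" "z \<in> X"
  shows "rack_iter (\<star>) i x y \<star> z = rack_iter (\<star>) i (x \<star> z) (y \<star> z)"
proof (induction i)
  case (Suc i)
  then show ?case
    using assms by (simp add: right_distrib rack_iter_closed)
qed simp

text \<open>Right translation by \<open>y\<close> is an endomorphism, hence so are its powers. This
  handles faces that delete an entry to the left of \<open>y\<close>: there the acting entry has
  itself been moved by the same power.\<close>

lemma rack_iter_hom:
  assumes "x \<in> X" "y \<in> X" "z \<in> X"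
  shows "rack_iter (\<star>) i x y \<star> rack_iter (\<star>) i z y = rack_iter (\<star>) i (x \<star> z) y"
proof (induction i)
  case (Suc i)
  then show ?case
    using assms right_distrib[of "rack_iter (\<star>) i x y" "rack_iter (\<star>) i z y" y]
    by (simp add: rack_iter_closed)
qed simp

lemma set_face_delta:
  assumes "set xs \<subseteq> X" "0 < h" "h \<le> length xs"
  shows "set (face_delta (\<star>) h xs) \<subseteq> X"
proof -
  have "xs ! (h - 1) \<in> X"
    using assms by (intro subsetD[OF assms(1)] nth_mem) auto
  then show ?thesis
    using assms(1)
    by (auto simp: face_delta_def dest!: in_set_takeD in_set_dropD intro!: op_closed)
qed

lemma face_delta_map_rack_iter:
  assumes "set us \<subseteq> X" "y \<in> X" "0 < h" "h \<le> length us"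
  shows "face_delta (\<star>) h (map (\<lambda>x. rack_iter (\<star>) i x y) us)
    = map (\<lambda>x. rack_iter (\<star>) i x y) (face_delta (\<star>) h us)"
proof -
  have "us ! (h - 1) \<in> X"
    using assms by (intro subsetD[OF assms(1)] nth_mem) auto
  then show ?thesis
    using assms
    by (auto simp: face_delta_def take_map drop_map rack_iter_hom subset_iff dest: in_set_takeD)
qed

end

section \<open>The subgroups generated by the orbit sums\<close>

definition S_gen :: "('a \<Rightarrow> 'a \<Rightarrow> 'a) \<Rightarrow> nat \<Rightarrow> 'a list \<Rightarrow> 'a \<Rightarrow> 'a list \<Rightarrow> ('a list \<Rightarrow>\<^sub>0 int)"
  where "S_gen rop k us y vs
    = (\<Sum>i<k. frag_of (map (\<lambda>x. rack_iter rop i x y) us @ y # vs))"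

lemma S_generators_eq:
  "S_generators X rop k n = {S_gen rop k us y vs | us y vs.
     set us \<subseteq> X \<and> y \<in> X \<and> set vs \<subseteq> X \<and> int (length us + 1 + length vs) = n}"
  by (simp add: S_generators_def S_gen_def)

lemma keys_sum_frag_of_subset:
  "finite I \<Longrightarrow> (\<And>i. i \<in> I \<Longrightarrow> g i \<in> T) \<Longrightarrow> Poly_Mapping.keys (\<Sum>i\<in>I. frag_of (g i)) \<subseteq> T"
  by (rule order_trans[OF Poly_Mapping.keys_sum]) auto

context rack
begin

lemma S_generators_subset: "S_generators X (\<star>) k n \<subseteq> carrier (rack_chain_group X n)"
proof -
  have "S_gen (\<star>) k us y vs \<in> carrier (rack_chain_group X n)"
    if "set us \<subseteq> X" "y \<in> X" "set vs \<subseteq> X" "int (length us + 1 + length vs) = n" for us y vs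
    unfolding S_gen_def rack_chain_group_def carrier_free_Abelian_group_iff
  proof (rule keys_sum_frag_of_subset)
    show "map (\<lambda>x. rack_iter (\<star>) i x y) us @ y # vs \<in> rack_tuples X n" for i
      using that by (auto simp: rack_tuples_def intro: rack_iter_closed)
  qed simp
  then show ?thesis
    unfolding S_generators_eq by blast
qed

lemma S_chains_subgroup: "subgroup (S_chains X (\<star>) k n) (rack_chain_group X n)"
  unfolding S_chains_def
  by (rule group.generate_is_subgroup)
    (use S_generators_subset in \<open>auto simp: rack_chain_group_def\<close>)

lemma S_chains_zero: "0 \<in> S_chains X (\<star>) k n"
  using subgroup.one_closed[OF S_chains_subgroup[of k n]] by (simp add: rack_chain_group_def)

lemma S_chains_add:
  "a \<in> S_chains X (\<star>) k n \<Longrightarrow> b \<in> S_chains X (\<star>) k n \<Longrightarrow> a + b \<in> S_chains X (\<star>) k n"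
  using subgroup.m_closed[OF S_chains_subgroup[of k n], of a b] by (simp add: rack_chain_group_def)

lemma S_chains_minus:
  assumes "a \<in> S_chains X (\<star>) k n"
  shows "- a \<in> S_chains X (\<star>) k n"
proof -
  \<comment> \<open>The group inverse can be identified with \<open>- a\<close> only once
    \<open>a\<close> is known to lie in the carrier.\<close>
  have "a \<in> carrier (rack_chain_group X n)"
    using assms subgroup.subset[OF S_chains_subgroup] by blast
  then show ?thesis
    using subgroup.m_inv_closed[OF S_chains_subgroup assms]
    by (simp add: rack_chain_group_def carrier_free_Abelian_group_iff)
qed

lemma S_chains_diff:
  "a \<in> S_chains X (\<star>) k n \<Longrightarrow> b \<in> S_chains X (\<star>) k n \<Longrightarrow> a - b \<in> S_chains X (\<star>) k n"
  using S_chains_add[of a k n "- b"] S_chains_minus[of b k n] by simp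

lemma S_chains_sum:
  "(\<And>i. i \<in> I \<Longrightarrow> f i \<in> S_chains X (\<star>) k n) \<Longrightarrow> (\<Sum>i\<in>I. f i) \<in> S_chains X (\<star>) k n"
  by (induction I rule: infinite_finite_induct) (auto intro: S_chains_zero S_chains_add)

lemma S_chains_sign:
  "a \<in> S_chains X (\<star>) k n \<Longrightarrow> frag_cmul ((-1) ^ h) a \<in> S_chains X (\<star>) k n"
  by (cases "even h") (auto intro: S_chains_minus)

lemma S_gen_in_S_chains:
  assumes "set us \<subseteq> X" "y \<in> X" "set vs \<subseteq> X" "int (length us + 1 + length vs) = n"
  shows "S_gen (\<star>) k us y vs \<in> S_chains X (\<star>) k n"
  unfolding S_chains_def S_generators_eq using assms by (intro generate.incl) blast

section \<open>Faces of a generator and closure under the boundary\<close>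

lemma boundary_S_gen:
  "rack_boundary (\<star>) n (S_gen (\<star>) k us y vs)
    = (\<Sum>h\<in>{2..nat n}. frag_cmul ((-1) ^ h)
        ((\<Sum>i<k. frag_of (face_d h (map (\<lambda>x. rack_iter (\<star>) i x y) us @ y # vs)))
        - (\<Sum>i<k. frag_of (face_delta (\<star>) h (map (\<lambda>x. rack_iter (\<star>) i x y) us @ y # vs)))))"
  unfolding rack_boundary_def S_gen_def frag_extend_sum[OF finite_lessThan] o_def frag_extend_of
  \<comment> \<open>The sum over \<open>i\<close> moves inside the sum over \<open>h\<close>, so
    that each face is taken of the whole orbit sum; only such sums are recognisable as
    generators.\<close>
  by (subst sum.swap) (intro sum.cong refl, simp only: frag_cmul_sum flip: sum_subtractf)

lemma faces_left:
  assumes "set us \<subseteq> X" "y \<in> X" "0 < h" "h \<le> length us"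
  shows
    "(\<Sum>i<k. frag_of (face_d h (map (\<lambda>x. rack_iter (\<star>) i x y) us @ y # vs)))
      = S_gen (\<star>) k (face_d h us) y vs"
    "(\<Sum>i<k. frag_of (face_delta (\<star>) h (map (\<lambda>x. rack_iter (\<star>) i x y) us @ y # vs)))
      = S_gen (\<star>) k (face_delta (\<star>) h us) y vs"
  using assms
  by (simp_all add: S_gen_def face_d_append face_delta_append face_d_map face_delta_map_rack_iter)

lemma faces_middle:
  assumes S: "satisfies_S X (\<star>) k" and "set us \<subseteq> X" "y \<in> X"
  shows "(\<Sum>i<k. frag_of
        (face_delta (\<star>) (Suc (length us)) (map (\<lambda>x. rack_iter (\<star>) i x y) us @ y # vs)))
    = (\<Sum>i<k. frag_of
        (face_d (Suc (length us)) (map (\<lambda>x. rack_iter (\<star>) i x y) us @ y # vs)))"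
proof -
  \<comment> \<open>Position \<open>Suc (length us)\<close> is that of \<open>y\<close>. Deleting it
    from the \<open>i\<close>-th summand gives \<open>f i\<close> for \<open>face_d\<close>, and
    \<open>f (Suc i)\<close> for \<open>face_delta\<close>, where \<open>y\<close> acts once more on
    the prefix.\<close>
  define f where "f i = frag_of (map (\<lambda>x. rack_iter (\<star>) i x y) us @ vs)" for i
  have "f k = f 0"
  proof -
    have "map (\<lambda>x. rack_iter (\<star>) k x y) us = map (\<lambda>x. rack_iter (\<star>) 0 x y) us"
      using assms by (intro map_cong) (auto simp: satisfies_S_def)
    then show ?thesis
      unfolding f_def by (rule arg_cong)
  qed
  then have "(\<Sum>i<k. f (Suc i)) = (\<Sum>i<k. f i)"
    using sum_lessThan_telescope[of f k] by (simp add: sum_subtractf)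
  then show ?thesis
    by (simp add: f_def face_d_def face_delta_def nth_append o_def)
qed

text \<open>The deleted entry is \<open>z\<close>, in position \<open>m\<close> of
  \<open>vs\<close>. In the second equation \<open>z\<close> acts on everything before it, so
  \<open>rack_iter_translate\<close> turns iterates along \<open>y\<close> into iterates along
  \<open>y \<star> z\<close>; the new distinguished entry is therefore
  \<open>y \<star> z\<close>.\<close>

lemma faces_right:
  assumes "set us \<subseteq> X" "y \<in> X" "set vs \<subseteq> X" "0 < m" "m \<le> length vs"
  defines "z \<equiv> vs ! (m - 1)"
  shows
    "(\<Sum>i<k. frag_of (face_d (Suc (length us) + m)
        (map (\<lambda>x. rack_iter (\<star>) i x y) us @ y # vs)))
      = S_gen (\<star>) k us y (face_d m vs)"
    "(\<Sum>i<k. frag_of (face_delta (\<star>) (Suc (length us) + m)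
        (map (\<lambda>x. rack_iter (\<star>) i x y) us @ y # vs)))
      = S_gen (\<star>) k (map (\<lambda>x. x \<star> z) us) (y \<star> z) (face_delta (\<star>) m vs)"
proof -
  obtain p where m: "m = Suc p"
    using assms by (cases m) auto
  have "z \<in> X"
    using assms by (auto intro!: subsetD[OF assms(3)] nth_mem simp: z_def)
  then have us: "map (\<lambda>x. rack_iter (\<star>) i x y \<star> z) us
      = map (\<lambda>x. rack_iter (\<star>) i (x \<star> z) (y \<star> z)) us" for i
    using assms by (auto simp: rack_iter_translate)
  have p: "z = vs ! p"
    by (simp add: m z_def)
  show
    "(\<Sum>i<k. frag_of (face_d (Suc (length us) + m)
        (map (\<lambda>x. rack_iter (\<star>) i x y) us @ y # vs)))
      = S_gen (\<star>) k us y (face_d m vs)"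
    "(\<Sum>i<k. frag_of (face_delta (\<star>) (Suc (length us) + m)
        (map (\<lambda>x. rack_iter (\<star>) i x y) us @ y # vs)))
      = S_gen (\<star>) k (map (\<lambda>x. x \<star> z) us) (y \<star> z) (face_delta (\<star>) m vs)"
    using us
    by (simp_all add: m S_gen_def p face_d_def face_delta_def o_def nth_append del: map_eq_conv)
qed

lemma boundary_S_gen_in_S_chains:
  assumes S: "satisfies_S X (\<star>) k"
    and us: "set us \<subseteq> X" and y: "y \<in> X" and vs: "set vs \<subseteq> X"
    and n: "int (length us + 1 + length vs) = n"
  shows "rack_boundary (\<star>) n (S_gen (\<star>) k us y vs) \<in> S_chains X (\<star>) k (n - 1)"
  unfolding boundary_S_gen
proof (intro S_chains_sum S_chains_sign)
  fix h
  assume h: "h \<in> {2..nat n}"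
  let ?D = "\<Sum>i<k. frag_of (face_d h (map (\<lambda>x. rack_iter (\<star>) i x y) us @ y # vs))"
  let ?E = "\<Sum>i<k. frag_of (face_delta (\<star>) h (map (\<lambda>x. rack_iter (\<star>) i x y) us @ y # vs))"
  \<comment> \<open>The deleted entry lies to the left of \<open>y\<close>, is \<open>y\<close>
    itself, or lies to the right of \<open>y\<close>.\<close>
  consider "h \<le> length us" | "h = Suc (length us)" | "Suc (length us) < h"
    by linarith
  then show "?D - ?E \<in> S_chains X (\<star>) k (n - 1)"
  proof cases
    case 1
    then show ?thesis
      using h n us y vs set_face_d[of h us] set_face_delta[of us h]
      by (auto simp: faces_left length_face_d length_face_delta
          intro!: S_chains_diff S_gen_in_S_chains)
  next
    case 2
    then show ?thesis
      using faces_middle[OF S us y, of vs] by (simp add: S_chains_zero)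
  next
    case 3
    \<comment> \<open>\<open>m\<close> is the position of the deleted entry within
      \<open>vs\<close>, counted from 1.\<close>
    define m where "m = h - Suc (length us)"
    have m: "h = Suc (length us) + m" "0 < m" "m \<le> length vs"
      using 3 h n by (auto simp: m_def)
    then have z: "vs ! (m - 1) \<in> X"
      by (intro subsetD[OF vs] nth_mem) auto
    show ?thesis
      unfolding m(1) faces_right[OF us y vs m(2,3)]
      using n m us y vs z set_face_d[of m vs] set_face_delta[of vs m]
      by (intro S_chains_diff S_gen_in_S_chains)
        (auto simp: length_face_d length_face_delta op_closed subset_iff)
  qed
qed

text \<open>The boundary is additive, so induction over the generated subgroup reduces the inclusion
  to single generators.\<close>

lemma boundary_S_chains:
  assumes S: "satisfies_S X (\<star>) k"
  shows "rack_boundary (\<star>) n ` S_chains X (\<star>) k n \<subseteq> S_chains X (\<star>) k (n - 1)"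
proof (intro image_subsetI)
  have gen: "rack_boundary (\<star>) n g \<in> S_chains X (\<star>) k (n - 1)"
    if "g \<in> S_generators X (\<star>) k n" for g
    using that S by (auto simp: S_generators_eq intro: boundary_S_gen_in_S_chains)
  fix c
  assume "c \<in> S_chains X (\<star>) k n"
  then show "rack_boundary (\<star>) n c \<in> S_chains X (\<star>) k (n - 1)"
    unfolding S_chains_def[of X "(\<star>)" k n]
  proof (induction rule: generate.induct)
    case one
    show ?case
      by (simp add: rack_chain_group_def rack_boundary_def S_chains_zero)
  next
    case (incl g)
    then show ?case
      by (rule gen)
  next
    case (inv g)
    then have "inv\<^bsub>rack_chain_group X n\<^esub> g = - g"
      using subsetD[OF S_generators_subset inv]
      by (simp add: rack_chain_group_def carrier_free_Abelian_group_iff)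
    then show ?case
      using S_chains_minus[OF gen[OF inv]]
      by (simp add: rack_boundary_def frag_extend_minus)
  next
    case (eng a b)
    then show ?case
      by (simp add: rack_chain_group_def rack_boundary_def frag_extend_add S_chains_add)
  qed
qed

text \<open>The chain is the generator with prefix \<open>[x]\<close> and empty suffix. In degree 2
  the boundary has only the term \<open>h = 2\<close>, which deletes \<open>y\<close>, and
  \<open>faces_middle\<close> makes it vanish.\<close>

lemma L_chain_cycle:
  assumes S: "satisfies_S X (\<star>) k" and "x \<in> X" "y \<in> X"
  shows "L_chain (\<star>) k x y \<in> carrier (rack_chain_group X 2)"
    and "rack_boundary (\<star>) 2 (L_chain (\<star>) k x y) = 0"
proof -
  have L: "L_chain (\<star>) k x y = S_gen (\<star>) k [x] y []"
    by (simp add: L_chain_def S_gen_def)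
  show "L_chain (\<star>) k x y \<in> carrier (rack_chain_group X 2)"
    unfolding L using assms
    by (intro subsetD[OF S_generators_subset]) (force simp: S_generators_eq)
  show "rack_boundary (\<star>) 2 (L_chain (\<star>) k x y) = 0"
    using faces_middle[OF S, of "[x]" y "[]"] assms
    by (simp add: L boundary_S_gen numeral_2_eq_2)
qed

end

section \<open>Evaluation of 2-chains and abelian extensions\<close>

lemma finprod_lessThan_Suc:
  assumes "comm_monoid A" "\<And>i. i \<le> n \<Longrightarrow> f i \<in> carrier A"
  shows "finprod A f {..<Suc n} = finprod A f {..<n} \<otimes>\<^bsub>A\<^esub> f n"
proof -
  interpret comm_monoid A by fact
  have "finprod A f {..<Suc n} = f n \<otimes>\<^bsub>A\<^esub> finprod A f {..<n}"
    unfolding lessThan_Suc using assms(2) by (intro finprod_insert) auto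
  also have "\<dots> = finprod A f {..<n} \<otimes>\<^bsub>A\<^esub> f n"
    using assms(2) by (intro m_comm finprod_closed) auto
  finally show ?thesis .
qed

context comm_group
begin

text \<open>A list outside the support has coefficient 0 and contributes the factor
  \<open>\<one>\<close>.\<close>

lemma eval_2_chain_superset:
  assumes "finite T" "Poly_Mapping.keys c \<subseteq> T"
    and "\<And>xs. xs \<in> T \<Longrightarrow> \<phi> (xs ! 0, xs ! 1) \<in> carrier G"
  shows "eval_2_chain G \<phi> c
    = (\<Otimes>xs\<in>T. \<phi> (xs ! 0, xs ! 1) [^] Poly_Mapping.lookup c xs)"
  unfolding eval_2_chain_def using assms
  by (intro finprod_mono_neutral_cong_left) (auto simp: in_keys_iff)

lemma eval_2_chain_add:
  assumes "\<And>xs. xs \<in> Poly_Mapping.keys c \<union> Poly_Mapping.keys d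
    \<Longrightarrow> \<phi> (xs ! 0, xs ! 1) \<in> carrier G"
  shows "eval_2_chain G \<phi> (c + d) = eval_2_chain G \<phi> c \<otimes> eval_2_chain G \<phi> d"
proof -
  \<comment> \<open>Coefficients may cancel in \<open>c + d\<close>, so its support can be smaller
    than this union. Evaluating all three chains over \<open>T\<close> lets the products be compared
    factor by factor.\<close>
  define T where "T = Poly_Mapping.keys c \<union> Poly_Mapping.keys d"
  have T: "finite T" "\<And>xs. xs \<in> T \<Longrightarrow> \<phi> (xs ! 0, xs ! 1) \<in> carrier G"
    using assms by (auto simp: T_def)
  have keys: "Poly_Mapping.keys c \<subseteq> T" "Poly_Mapping.keys d \<subseteq> T" "Poly_Mapping.keys (c + d) \<subseteq> T"
    using Poly_Mapping.keys_add[of c d] by (auto simp: T_def)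
  have eval: "eval_2_chain G \<phi> e
      = (\<Otimes>xs\<in>T. \<phi> (xs ! 0, xs ! 1) [^] Poly_Mapping.lookup e xs)" if "Poly_Mapping.keys e \<subseteq> T" for e
    using that T by (intro eval_2_chain_superset)
  have "eval_2_chain G \<phi> (c + d)
      = (\<Otimes>xs\<in>T. \<phi> (xs ! 0, xs ! 1) [^] Poly_Mapping.lookup c xs
          \<otimes> \<phi> (xs ! 0, xs ! 1) [^] Poly_Mapping.lookup d xs)"
    unfolding eval[OF keys(3)] using T
    by (intro finprod_cong') (auto simp: lookup_add int_pow_mult)
  also have "\<dots> = eval_2_chain G \<phi> c \<otimes> eval_2_chain G \<phi> d"
    unfolding eval[OF keys(1)] eval[OF keys(2)] using T
    by (intro finprod_multf) auto
  finally show ?thesis .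
qed

lemma eval_2_chain_frag_of:
  "\<phi> (x, y) \<in> carrier G \<Longrightarrow> eval_2_chain G \<phi> (frag_of [x, y]) = \<phi> (x, y)"
  by (simp add: eval_2_chain_def)

text \<open>The orbit of \<open>x\<close> may close up before \<open>k\<close> steps, so lists can
  repeat and coefficients can exceed 1. Adding one summand at a time by additivity avoids counting
  them.\<close>

lemma eval_2_chain_L_chain:
  assumes "\<And>i. \<phi> (rack_iter rop i x y, y) \<in> carrier G"
  shows "eval_2_chain G \<phi> (L_chain rop k x y) = (\<Otimes>i\<in>{..<k}. \<phi> (rack_iter rop i x y, y))"
proof (induction k)
  case 0
  show ?case
    by (simp add: L_chain_def eval_2_chain_def)
next
  case (Suc k)
  let ?c = "\<Sum>i<k. frag_of [rack_iter rop i x y, y]"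
  let ?d = "frag_of [rack_iter rop k x y, y]"
  have "Poly_Mapping.keys ?c \<subseteq> range (\<lambda>i. [rack_iter rop i x y, y])"
    by (rule keys_sum_frag_of_subset) auto
  then have "eval_2_chain G \<phi> (?c + ?d) = eval_2_chain G \<phi> ?c \<otimes> eval_2_chain G \<phi> ?d"
    using assms by (intro eval_2_chain_add) auto
  then show ?case
    using assms Suc finprod_lessThan_Suc[OF comm_monoid_axioms, of k]
    by (simp add: L_chain_def eval_2_chain_frag_of)
qed

text \<open>Each step multiplies the second coordinate by \<open>\<phi>\<close> at the current first
  coordinate, which runs through the orbit of \<open>x\<close> under \<open>y\<close>.\<close>

lemma rack_iter_ext_op:
  assumes "\<And>i. \<phi> (rack_iter rop i x y, y) \<in> carrier G" "a \<in> carrier G"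
  shows "rack_iter (ext_op rop G \<phi>) i (x, a) (y, b)
    = (rack_iter rop i x y, a \<otimes> (\<Otimes>j\<in>{..<i}. \<phi> (rack_iter rop j x y, y)))"
proof (induction i)
  case (Suc i)
  then show ?case
    using assms finprod_lessThan_Suc[OF comm_monoid_axioms, of i]
    by (simp add: ext_op_def m_assoc)
qed (use assms in simp)

lemma satisfies_S_ext_iff:
  assumes "rack X rop" "satisfies_S X rop k" "\<phi> \<in> X \<times> X \<rightarrow> carrier G"
  shows "satisfies_S (ext_carrier X G) (ext_op rop G \<phi>) k
    \<longleftrightarrow> (\<forall>x\<in>X. \<forall>y\<in>X. eval_2_chain G \<phi> (L_chain rop k x y) = \<one>)"
proof -
  interpret rack X rop by fact
  have \<phi>: "\<phi> (rack_iter rop i x y, y) \<in> carrier G" if "x \<in> X" "y \<in> X" for i x y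
    using assms(3) that rack_iter_closed by blast
  have "rack_iter (ext_op rop G \<phi>) k (x, a) (y, b) = (x, a)
      \<longleftrightarrow> eval_2_chain G \<phi> (L_chain rop k x y) = \<one>"
    if "x \<in> X" "y \<in> X" "a \<in> carrier G" for x y a b
  proof -
    \<comment> \<open>\<open>p\<close> is both the total change of the second coordinate after
      \<open>k\<close> steps and the value of \<open>\<phi>\<close> on the chain. The first
      coordinate returns to \<open>x\<close>, so the identity holds iff
      \<open>a \<otimes> p = a\<close>, that is, iff \<open>p = \<one>\<close>.\<close>
    define p where "p = (\<Otimes>i\<in>{..<k}. \<phi> (rack_iter rop i x y, y))"
    have "p \<in> carrier G"
      unfolding p_def using that \<phi> by (intro finprod_closed) auto
    moreover have "rack_iter rop k x y = x"
      using assms(2) that by (simp add: satisfies_S_def)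
    moreover have "rack_iter (ext_op rop G \<phi>) k (x, a) (y, b) = (rack_iter rop k x y, a \<otimes> p)"
      unfolding p_def using that \<phi> by (intro rack_iter_ext_op) auto
    moreover have "eval_2_chain G \<phi> (L_chain rop k x y) = p"
      unfolding p_def using that \<phi> by (intro eval_2_chain_L_chain) auto
    ultimately show ?thesis
      using that by simp
  qed
  \<comment> \<open>The criterion does not involve \<open>a\<close> and \<open>b\<close>. Since the
    carrier contains \<open>\<one>\<close>, every pair \<open>x\<close>, \<open>y\<close> occurs
    below some pair of elements of the extension.\<close>
  then show ?thesis
    by (force simp: satisfies_S_def ext_carrier_def)
qed

end

theorem corollary4p7:
  fixes X :: "'a set" and rop :: "'a \<Rightarrow> 'a \<Rightarrow> 'a" and k :: nat
  assumes "k > 1" and "quandle X rop" and "rack_of_type X rop k"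
  shows
    "(\<forall>x\<in>X. \<forall>y\<in>X.
        L_chain rop k x y \<in> carrier (rack_chain_group X 2) \<and>
        rack_boundary rop 2 (L_chain rop k x y) = 0)
     \<and>
     (\<forall>(A :: ('b, 'c) monoid_scheme) \<phi>.
        comm_group A \<and> rack_2_cocycle X rop A \<phi> \<longrightarrow>
        (satisfies_S (ext_carrier X A) (ext_op rop A \<phi>) k \<longleftrightarrow>
         (\<forall>x\<in>X. \<forall>y\<in>X. eval_2_chain A \<phi> (L_chain rop k x y) = \<one>\<^bsub>A\<^esub>)))
     \<and>
     (\<forall>n::int.
        subgroup (S_chains X rop k n) (rack_chain_group X n) \<and>
        rack_boundary rop n ` S_chains X rop k n \<subseteq> S_chains X rop k (n - 1))"
proof -
  interpret quandle X rop by fact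
  have S: "satisfies_S X rop k"
    using assms(3) by (simp add: rack_of_type_def)
  show ?thesis
  proof (intro conjI allI ballI impI)
    fix A :: "('b, 'c) monoid_scheme" and \<phi>
    assume "comm_group A \<and> rack_2_cocycle X rop A \<phi>"
    then show "satisfies_S (ext_carrier X A) (ext_op rop A \<phi>) k \<longleftrightarrow>
        (\<forall>x\<in>X. \<forall>y\<in>X. eval_2_chain A \<phi> (L_chain rop k x y) = \<one>\<^bsub>A\<^esub>)"
      using S rack_axioms
      by (intro comm_group.satisfies_S_ext_iff) (auto simp: rack_2_cocycle_def)
  qed (use S in \<open>simp_all add: L_chain_cycle S_chains_subgroup boundary_S_chains\<close>)
qed

end
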